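(* Let $A(\mathbb R)$ be the locally convex space of all real analytic functions $\mathbb R\to\mathbb R$. For $\varphi\in A(\mathbb R)$ let $f_\varphi: C(\mathbb R)\to C(\mathbb R)$ be the composition map $x\mapsto\varphi\circ x$, where $C(\mathbb R)$ is the real Fréchet space of continuous functions $\mathbb R\to\mathbb R$ with the topology of uniform convergence on bounded intervals. Then the set $$\{\varphi\in A(\mathbb R) : f_\varphi\text{ is real analytic}\}$$ is $A(\mathbb R)$-shy, where real analyticity of $f_\varphi$ means local existence of holomorphic extensions between complexifications (as defined in the context).
   Context: Topology of $A(\mathbb R)$: for each open $U\subseteq\mathbb C$ with $\mathbb R\subseteq U$ let $F_U$ be the real Fréchet space of those real analytic $x:\mathbb R\to\mathbb R$ that possess a holomorphic extension $U\to\mathbb C$, topologized by uniform convergence of the extensions on compact sets (of the connected component of $U$ containing $\mathbb R$, where the extension is unique). The vector space $A(\mathbb R)$, with pointwise operations, carries the strongest locally convex topology such that all the inclusions $F_U\to A(\mathbb R)$ are continuous and linear. Shyness: a subset $S$ of a real Hausdorff locally convex space $F$ is called $F$-shy if it is contained in a countable union of Borel sets $B$ of $F$ each having the property that there is a finite-dimensional linear subspace $M$ of $F$ such that for all $x\in B$ the set $B\cap\{x+v : v\in M\}$ has Lebesgue measure zero in the affine subspace $x+M$ (Lebesgue measure transported via a linear isomorphism $M\cong\mathbb R^{\dim M}$). Holomorphy: for complex Hausdorff locally convex spaces $G,H$ and open $W\subseteq G$, a map $g:W\to H$ is holomorphic if it is continuous and all iterated directional derivatives $d^{k}g(x;y_1,\dots,y_k)$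 (with complex increments) exist for all $k\ge 1$, $x\in W$, $y_1,\dots,y_k\in G$, and define continuous maps $d^kg:W\times G^k\to H$. Real analyticity: for a real Hausdorff locally convex space $E$, its complexification $E_{\rm cx}$ is the complex locally convex space with underlying set $E\times E$ (product topology, $(x,y)$ thought of as $x+iy$). A map $f:U\to F$, with $U$ open in $E$ and $E,F$ real Hausdorff locally convex spaces, is real analytic if for every $x_0\in U$ there are an open neighbourhood $W$ of $(x_0,0)$ in $E_{\rm cx}$ and a holomorphic map $g:W\to F_{\rm cx}$ such that for all $x$ with $(x,0)\in W$ one has $x\in U$ and $g(x,0)=(f(x),0)$. *)

theory Defs
  imports "HOL-Complex_Analysis.Complex_Analysis"
begin

section \<open>Locally convex topologies\<close>

text \<open>
  Topologies are values of type \<open>'a topology\<close> rather than type class instances, since the topology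
  of \<open>A(\<real>)\<close> is characterised by comparison with all other locally convex topologies. The
  Hausdorff property is not part of the following predicate.
\<close>

definition locally_convex_topology :: "'a::real_vector topology \<Rightarrow> bool" where
  "locally_convex_topology T \<longleftrightarrow>
     topspace T = UNIV \<and>
     continuous_map (prod_topology T T) T (\<lambda>(x, y). x + y) \<and>
     continuous_map (prod_topology euclideanreal T) T (\<lambda>(c, x). c *\<^sub>R x) \<and>
     (\<forall>N. openin T N \<and> 0 \<in> N \<longrightarrow> (\<exists>V. openin T V \<and> 0 \<in> V \<and> convex V \<and> V \<subseteq> N))"

definition uniform_conv_topology ::
  "'x set \<Rightarrow> ('x \<Rightarrow> 'a \<Rightarrow> 'b::metric_space) \<Rightarrow> 'a set set \<Rightarrow> 'x topology" where
  "uniform_conv_topology X ev \<K> = topology (\<lambda>S. S \<subseteq> X \<and>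
     (\<forall>x\<in>S. \<exists>K\<in>\<K>. \<exists>\<epsilon>>0. \<forall>y\<in>X. (\<forall>t\<in>K. dist (ev x t) (ev y t) < \<epsilon>) \<longrightarrow> y \<in> S))"

lemma openin_uniform_conv_topology:
  assumes ne: "\<K> \<noteq> {}"
    and dir: "\<forall>K\<in>\<K>. \<forall>L\<in>\<K>. \<exists>M\<in>\<K>. K \<union> L \<subseteq> M"
  shows "openin (uniform_conv_topology X ev \<K>) S \<longleftrightarrow> S \<subseteq> X \<and>
     (\<forall>x\<in>S. \<exists>K\<in>\<K>. \<exists>\<epsilon>>0. \<forall>y\<in>X. (\<forall>t\<in>K. dist (ev x t) (ev y t) < \<epsilon>) \<longrightarrow> y \<in> S)"
    (is "_ \<longleftrightarrow> ?P S")
proof -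
  have "istopology ?P"
    unfolding istopology_def
  proof (intro conjI allI impI)
    fix S T assume S: "?P S" and T: "?P T"
    show "S \<inter> T \<subseteq> X" using S by blast
    show "\<forall>x\<in>S \<inter> T. \<exists>K\<in>\<K>. \<exists>\<epsilon>>0. \<forall>y\<in>X. (\<forall>t\<in>K. dist (ev x t) (ev y t) < \<epsilon>) \<longrightarrow> y \<in> S \<inter> T"
    proof
      fix x assume x: "x \<in> S \<inter> T"
      obtain K e where K: "K \<in> \<K>" "e > 0"
        "\<And>y. y \<in> X \<Longrightarrow> (\<forall>t\<in>K. dist (ev x t) (ev y t) < e) \<Longrightarrow> y \<in> S"
        using S x by (meson IntD1)
      obtain L d where L: "L \<in> \<K>" "d > 0"
        "\<And>y. y \<in> X \<Longrightarrow> (\<forall>t\<in>L. dist (ev x t) (ev y t) < d) \<Longrightarrow> y \<in> T"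
        using T x by (meson IntD2)
      obtain M where M: "M \<in> \<K>" "K \<union> L \<subseteq> M"
        using dir K(1) L(1) by blast
      have "y \<in> S \<inter> T" if "y \<in> X" "\<forall>t\<in>M. dist (ev x t) (ev y t) < min e d" for y
      proof
        show "y \<in> S" using that M by (intro K(3)) auto
        show "y \<in> T" using that M by (intro L(3)) auto
      qed
      then show "\<exists>K\<in>\<K>. \<exists>\<epsilon>>0. \<forall>y\<in>X. (\<forall>t\<in>K. dist (ev x t) (ev y t) < \<epsilon>) \<longrightarrow> y \<in> S \<inter> T"
        using M(1) K(2) L(2) by (intro bexI[of _ M] exI[of _ "min e d"]) auto
    qed
  next
    fix \<S> assume a: "\<forall>S\<in>\<S>. ?P S"
    show "\<Union>\<S> \<subseteq> X" using a by blast
    show "\<forall>x\<in>\<Union>\<S>. \<exists>K\<in>\<K>. \<exists>\<epsilon>>0. \<forall>y\<in>X. (\<forall>t\<in>K. dist (ev x t) (ev y t) < \<epsilon>) \<longrightarrow> y \<in> \<Union>\<S>"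
    proof
      fix x assume "x \<in> \<Union>\<S>"
      then obtain S where S: "S \<in> \<S>" "x \<in> S" by blast
      then obtain K e where "K \<in> \<K>" "e > 0"
        "\<And>y. y \<in> X \<Longrightarrow> (\<forall>t\<in>K. dist (ev x t) (ev y t) < e) \<Longrightarrow> y \<in> S"
        using a by meson
      then show "\<exists>K\<in>\<K>. \<exists>\<epsilon>>0. \<forall>y\<in>X. (\<forall>t\<in>K. dist (ev x t) (ev y t) < \<epsilon>) \<longrightarrow> y \<in> \<Union>\<S>"
        using S(1) by (intro bexI[of _ K] exI[of _ e]) auto
    qed
  qed
  then show ?thesis
    unfolding uniform_conv_topology_def by simp
qed

lemma topspace_uniform_conv_topology:
  assumes "\<K> \<noteq> {}" "\<forall>K\<in>\<K>. \<forall>L\<in>\<K>. \<exists>M\<in>\<K>. K \<union> L \<subseteq> M"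
  shows "topspace (uniform_conv_topology X ev \<K>) = X"
proof
  show "topspace (uniform_conv_topology X ev \<K>) \<subseteq> X"
    using openin_uniform_conv_topology[OF assms] openin_topspace by metis
  have "openin (uniform_conv_topology X ev \<K>) X"
    using assms(1) by (subst openin_uniform_conv_topology[OF assms]) (auto intro: exI[of _ 1])
  then show "X \<subseteq> topspace (uniform_conv_topology X ev \<K>)"
    by (rule openin_subset)
qed


section \<open>The space \<open>C(\<real>)\<close>\<close>

typedef cont_fun = "{x :: real \<Rightarrow> real. continuous_on UNIV x}"
  morphisms cont_apply Abs_cont_fun
  by (rule exI[of _ "\<lambda>_. 0"]) simp

setup_lifting type_definition_cont_fun

instantiation cont_fun :: real_vector
begin

lift_definition zero_cont_fun :: cont_fun is "\<lambda>_. 0" by simp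
lift_definition plus_cont_fun :: "cont_fun \<Rightarrow> cont_fun \<Rightarrow> cont_fun" is "\<lambda>x y t. x t + y t"
  by (intro continuous_intros)
lift_definition minus_cont_fun :: "cont_fun \<Rightarrow> cont_fun \<Rightarrow> cont_fun" is "\<lambda>x y t. x t - y t"
  by (intro continuous_intros)
lift_definition uminus_cont_fun :: "cont_fun \<Rightarrow> cont_fun" is "\<lambda>x t. - x t"
  by (intro continuous_intros)
lift_definition scaleR_cont_fun :: "real \<Rightarrow> cont_fun \<Rightarrow> cont_fun" is "\<lambda>c x t. c * x t"
  by (intro continuous_intros)

instance
  by standard (transfer; auto simp: fun_eq_iff algebra_simps)+

end

definition cont_topology :: "cont_fun topology" where
  "cont_topology = uniform_conv_topology UNIV cont_apply {{a..b} | a b. True}"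

lemma openin_cont_topology:
  "openin cont_topology S \<longleftrightarrow>
     (\<forall>x\<in>S. \<exists>a b. \<exists>\<epsilon>>0. \<forall>y. (\<forall>t\<in>{a..b}. dist (cont_apply x t) (cont_apply y t) < \<epsilon>) \<longrightarrow> y \<in> S)"
proof -
  have dir: "\<forall>K\<in>{{a..b} | a b. True}. \<forall>L\<in>{{a..b} | a b. True}.
      \<exists>M\<in>{{a..b} | a b. True}. K \<union> L \<subseteq> (M :: real set)"
  proof (intro ballI)
    fix K L :: "real set" assume "K \<in> {{a..b} | a b. True}" "L \<in> {{a..b} | a b. True}"
    then obtain a b c d where "K = {a..b}" "L = {c..d}" by blast
    then have "K \<union> L \<subseteq> {min a c..max b d}" by auto
    then show "\<exists>M\<in>{{a..b} | a b. True}. K \<union> L \<subseteq> M" by blast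
  qed
  have ne: "{{a..b} | a b. True} \<noteq> ({} :: real set set)" by blast
  have "(\<exists>K\<in>{{a..b} | a b. True}. Q K) \<longleftrightarrow> (\<exists>a b. Q {a..b})" for Q :: "real set \<Rightarrow> bool"
    by blast
  then show ?thesis
    unfolding cont_topology_def openin_uniform_conv_topology[OF ne dir] by simp
qed

lemma Hausdorff_cont_topology: "Hausdorff_space cont_topology"
  unfolding Hausdorff_space_def
proof (intro allI impI, elim conjE)
  fix x y :: cont_fun assume "x \<noteq> y"
  then obtain t where t: "cont_apply x t \<noteq> cont_apply y t"
    by (metis cont_apply_inject ext)
  have op: "openin cont_topology {u. cont_apply u t \<in> P}" if P: "open P" for P
    unfolding openin_cont_topology
  proof
    fix u assume "u \<in> {u. cont_apply u t \<in> P}"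
    then obtain e where "e > 0" "\<forall>r. dist r (cont_apply u t) < e \<longrightarrow> r \<in> P"
      using P by (auto simp: open_dist)
    then show "\<exists>a b. \<exists>\<epsilon>>0. \<forall>v. (\<forall>s\<in>{a..b}. dist (cont_apply u s) (cont_apply v s) < \<epsilon>) \<longrightarrow>
        v \<in> {u. cont_apply u t \<in> P}"
      by (intro exI[of _ t] exI[of _ e]) (auto simp: dist_commute)
  qed
  obtain P Q' where "open P" "open Q'" "cont_apply x t \<in> P" "cont_apply y t \<in> Q'" "P \<inter> Q' = {}"
    using hausdorff[OF t] by blast
  then show "\<exists>V W. openin cont_topology V \<and> openin cont_topology W \<and> x \<in> V \<and> y \<in> W \<and> disjnt V W"
    by (intro exI[of _ "{u. cont_apply u t \<in> P}"] exI[of _ "{u. cont_apply u t \<in> Q'}"])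
      (auto simp: op disjnt_def)
qed


section \<open>The space \<open>A(\<real>)\<close>\<close>

definition real_analytic_fun :: "(real \<Rightarrow> real) \<Rightarrow> bool" where
  "real_analytic_fun x \<longleftrightarrow> (\<forall>t. \<exists>F. (\<lambda>h. x (t + h)) has_fps_expansion F)"

lemma real_analytic_fun_imp_continuous: "real_analytic_fun x \<Longrightarrow> continuous_on UNIV x"
proof -
  assume x: "real_analytic_fun x"
  have "isCont x t" for t
  proof -
    obtain F where "(\<lambda>h. x (t + h)) has_fps_expansion F"
      using x by (auto simp: real_analytic_fun_def)
    then have "isCont (\<lambda>h. x (t + h)) 0"
      by (rule has_fps_expansion_imp_continuous)
    then show ?thesis
      by (simp add: isCont_iff)
  qed
  then show ?thesis
    by (simp add: continuous_at_imp_continuous_on)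
qed

typedef ana_fun = "{x :: real \<Rightarrow> real. real_analytic_fun x}"
  morphisms ana_apply Abs_ana_fun
  unfolding real_analytic_fun_def
  by (rule exI[of _ "\<lambda>_. 0"]) (auto intro: has_fps_expansion_0)

setup_lifting type_definition_ana_fun

instantiation ana_fun :: real_vector
begin

lift_definition zero_ana_fun :: ana_fun is "\<lambda>_. 0"
  unfolding real_analytic_fun_def by (auto intro: has_fps_expansion_0)
lift_definition plus_ana_fun :: "ana_fun \<Rightarrow> ana_fun \<Rightarrow> ana_fun" is "\<lambda>x y t. x t + y t"
  unfolding real_analytic_fun_def by (fast intro: has_fps_expansion_add)
lift_definition minus_ana_fun :: "ana_fun \<Rightarrow> ana_fun \<Rightarrow> ana_fun" is "\<lambda>x y t. x t - y t"
  unfolding real_analytic_fun_def by (fast intro: has_fps_expansion_diff)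
lift_definition uminus_ana_fun :: "ana_fun \<Rightarrow> ana_fun" is "\<lambda>x t. - x t"
  unfolding real_analytic_fun_def by (fast intro: has_fps_expansion_minus)
lift_definition scaleR_ana_fun :: "real \<Rightarrow> ana_fun \<Rightarrow> ana_fun" is "\<lambda>c x t. c * x t"
  unfolding real_analytic_fun_def by (fast intro: has_fps_expansion_cmult_left)

instance
  by standard (transfer; auto simp: fun_eq_iff algebra_simps)+

end

definition extends_hol :: "complex set \<Rightarrow> ana_fun \<Rightarrow> (complex \<Rightarrow> complex) \<Rightarrow> bool" where
  "extends_hol U x h \<longleftrightarrow> h holomorphic_on U \<and> (\<forall>t. h (of_real t) = of_real (ana_apply x t))"

definition F_space :: "complex set \<Rightarrow> ana_fun set" where
  "F_space U = {x. \<exists>h. extends_hol U x h}"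

text \<open>The extension is only unique on the connected component of \<open>U\<close> that contains \<open>\<real>\<close>;
  it is never evaluated elsewhere below.\<close>

definition hol_ext :: "complex set \<Rightarrow> ana_fun \<Rightarrow> complex \<Rightarrow> complex" where
  "hol_ext U x = (SOME h. extends_hol U x h)"

definition F_topology :: "complex set \<Rightarrow> ana_fun topology" where
  "F_topology U = uniform_conv_topology (F_space U) (hol_ext U)
     {K. compact K \<and> K \<subseteq> connected_component_set U 0}"

lemma openin_F_topology:
  "openin (F_topology U) S \<longleftrightarrow> S \<subseteq> F_space U \<and>
     (\<forall>x\<in>S. \<exists>K. compact K \<and> K \<subseteq> connected_component_set U 0 \<and>
        (\<exists>\<epsilon>>0. \<forall>y\<in>F_space U. (\<forall>z\<in>K. dist (hol_ext U x z) (hol_ext U y z) < \<epsilon>) \<longrightarrow> y \<in> S))"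
proof -
  let ?K = "{K. compact K \<and> K \<subseteq> connected_component_set U 0}"
  have "{} \<in> ?K" by simp
  then have ne: "?K \<noteq> {}" by (metis empty_iff)
  have dir: "\<forall>K\<in>?K. \<forall>L\<in>?K. \<exists>M\<in>?K. K \<union> L \<subseteq> M"
  proof (intro ballI)
    fix K L assume "K \<in> ?K" "L \<in> ?K"
    then show "\<exists>M\<in>?K. K \<union> L \<subseteq> M" by (intro bexI[of _ "K \<union> L"]) auto
  qed
  show ?thesis
    unfolding F_topology_def openin_uniform_conv_topology[OF ne dir] Bex_def mem_Collect_eq conj_assoc
    by (rule refl)
qed

definition compatible_topology :: "ana_fun topology \<Rightarrow> bool" where
  "compatible_topology T \<longleftrightarrow> locally_convex_topology T \<and>
     (\<forall>U. open U \<and> range of_real \<subseteq> U \<longrightarrow> continuous_map (F_topology U) T (\<lambda>x. x))"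

text \<open>The supremum of all compatible topologies is itself compatible, so it is the strongest one;
  see \<open>compatible_ana_topology\<close> and \<open>ana_topology_strongest\<close>.\<close>

definition ana_topology :: "ana_fun topology" where
  "ana_topology = topology_generated_by {V. \<exists>T. compatible_topology T \<and> openin T V}"

lemma ana_topology_strongest:
  assumes "compatible_topology T" "openin T V"
  shows "openin ana_topology V"
  unfolding ana_topology_def using assms by (intro topology_generated_by_Basis) auto

lemma compatible_trivial: "compatible_topology (topology (\<lambda>S. S = {} \<or> S = UNIV))"
proof -
  let ?T = "topology (\<lambda>S. S = {} \<or> S = UNIV) :: ana_fun topology"
  have "istopology (\<lambda>S. S = {} \<or> S = (UNIV :: ana_fun set))"
    by (auto simp: istopology_def)
  then have op: "openin ?T S \<longleftrightarrow> S = {} \<or> S = UNIV" for S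
    by simp
  have top: "topspace ?T = UNIV"
    using op openin_subset by blast
  have cont: "continuous_map X ?T f" for X and f :: "'b \<Rightarrow> ana_fun"
    by (auto simp: continuous_map_def top op)
  show ?thesis
    unfolding compatible_topology_def locally_convex_topology_def
    by (auto simp: top op intro!: cont)
qed

lemma compatible_ana_topology: "compatible_topology ana_topology"
proof -
  let ?B = "{V. \<exists>T. compatible_topology T \<and> openin T V}"
  have lcD: "locally_convex_topology T" if "compatible_topology T" for T
    using that by (simp add: compatible_topology_def)
  have topT: "topspace T = UNIV" if "compatible_topology T" for T
    using lcD[OF that] by (simp add: locally_convex_topology_def)
  have UB: "\<Union>?B = UNIV"
    using compatible_trivial topT openin_topspace by (metis (mono_tags, lifting) CollectI Sup_upper UNIV_I top.extremum_uniqueI)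
  have top: "topspace ana_topology = UNIV"
    unfolding ana_topology_def topology_generated_by_topspace by (rule UB)
  have toJ: "continuous_map X ana_topology f"
    if "\<And>T. compatible_topology T \<Longrightarrow> continuous_map X T f" for X and f :: "'b \<Rightarrow> ana_fun"
    unfolding ana_topology_def
  proof (rule continuous_on_generated_topo)
    fix V assume "V \<in> ?B"
    then obtain T where "compatible_topology T" "openin T V" by blast
    with that[of T] show "openin X (f -` V \<inter> topspace X)"
      by (simp add: continuous_map_def vimage_def Int_def conj_commute)
  qed (use UB in auto)
  have fromJ: "continuous_map ana_topology T (\<lambda>x. x)" if "compatible_topology T" for T
    using that ana_topology_strongest by (auto simp: continuous_map_def top topT)
  have "continuous_map (prod_topology ana_topology ana_topology) ana_topology (\<lambda>(x, y). x + y)"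
  proof (rule toJ)
    fix T assume T: "compatible_topology T"
    have "continuous_map (prod_topology ana_topology ana_topology) (prod_topology T T) (\<lambda>(x, y). (x, y))"
      using fromJ[OF T] by (subst continuous_map_prod_top) auto
    from continuous_map_compose[OF this, of T "\<lambda>(x, y). x + y"] lcD[OF T]
    show "continuous_map (prod_topology ana_topology ana_topology) T (\<lambda>(x, y). x + y)"
      by (simp add: locally_convex_topology_def o_def case_prod_unfold)
  qed
  moreover have "continuous_map (prod_topology euclideanreal ana_topology) ana_topology (\<lambda>(c, x). c *\<^sub>R x)"
  proof (rule toJ)
    fix T assume T: "compatible_topology T"
    have "continuous_map (prod_topology euclideanreal ana_topology) (prod_topology euclideanreal T) (\<lambda>(x, y). (x, y))"
      using fromJ[OF T] by (subst continuous_map_prod_top) auto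
    from continuous_map_compose[OF this, of T "\<lambda>(c, x). c *\<^sub>R x"] lcD[OF T]
    show "continuous_map (prod_topology euclideanreal ana_topology) T (\<lambda>(c, x). c *\<^sub>R x)"
      by (simp add: locally_convex_topology_def o_def case_prod_unfold)
  qed
  moreover have "\<exists>V. openin ana_topology V \<and> 0 \<in> V \<and> convex V \<and> V \<subseteq> N"
    if N: "openin ana_topology N" "0 \<in> N" for N
  proof -
    have "generate_topology_on ?B N"
      using N(1) by (simp add: ana_topology_def openin_topology_generated_by_iff)
    then show ?thesis
      using N(2)
    proof (induction rule: generate_topology_on.induct)
      case (Int a b)
      then obtain V W where "openin ana_topology V" "0 \<in> V" "convex V" "V \<subseteq> a"
        "openin ana_topology W" "0 \<in> W" "convex W" "W \<subseteq> b" by blast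
      then show ?case
        by (intro exI[of _ "V \<inter> W"]) (auto intro: convex_Int)
    next
      case (UN K)
      then show ?case by (meson UnionE Sup_upper subset_trans)
    next
      case (Basis s)
      then obtain T where T: "compatible_topology T" "openin T s" by blast
      then obtain V where "openin T V" "0 \<in> V" "convex V" "V \<subseteq> s"
        using lcD[OF T(1)] Basis(2) by (auto simp: locally_convex_topology_def)
      then show ?case using ana_topology_strongest[OF T(1)] by blast
    qed simp
  qed
  ultimately have "locally_convex_topology ana_topology"
    using top by (simp add: locally_convex_topology_def)
  moreover have "continuous_map (F_topology U) ana_topology (\<lambda>x. x)"
    if "open U" "range of_real \<subseteq> U" for U
    using that by (intro toJ) (simp add: compatible_topology_def)
  ultimately show ?thesis
    by (simp add: compatible_topology_def)
qed

lemma openin_ana_topology_eval: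
  assumes "open P"
  shows "openin ana_topology {u. ana_apply u t \<in> P}"
proof (rule ana_topology_strongest)
  let ?ev = "\<lambda>u. ana_apply u t"
  let ?T = "pullback_topology UNIV ?ev euclideanreal"
  have opT: "openin ?T S \<longleftrightarrow> (\<exists>P. open P \<and> S = {u. ?ev u \<in> P})" for S
    by (auto simp: openin_pullback_topology vimage_def)
  show "openin ?T {u. ?ev u \<in> P}"
    using assms opT by blast
  have top: "topspace ?T = UNIV"
    by (simp add: topspace_pullback_topology)
  have ev: "continuous_map ?T euclideanreal ?ev"
    by (rule continuous_map_pullback[OF continuous_map_id, unfolded id_o])
  have into: "continuous_map X ?T f" if "continuous_map X euclideanreal (\<lambda>u. ?ev (f u))"
    for X and f :: "'b \<Rightarrow> ana_fun"
    by (rule continuous_map_pullback') (use that in \<open>auto simp: o_def\<close>)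
  have add: "?ev (u + v) = ?ev u + ?ev v" for u v by transfer simp
  have scale: "?ev (c *\<^sub>R u) = c * ?ev u" for c u by transfer simp
  have zero: "?ev 0 = 0" by transfer simp
  have "continuous_map (prod_topology ?T ?T) ?T (\<lambda>(x, y). x + y)"
    unfolding case_prod_unfold
    by (rule into) (auto simp: add intro!: continuous_map_add
        continuous_map_compose[OF continuous_map_fst ev, unfolded o_def]
        continuous_map_compose[OF continuous_map_snd ev, unfolded o_def])
  moreover have "continuous_map (prod_topology euclideanreal ?T) ?T (\<lambda>(c, x). c *\<^sub>R x)"
    unfolding case_prod_unfold
    by (rule into) (auto simp: scale intro!: continuous_map_real_mult continuous_map_fst
        continuous_map_compose[OF continuous_map_snd ev, unfolded o_def])
  moreover have "\<exists>V. openin ?T V \<and> 0 \<in> V \<and> convex V \<and> V \<subseteq> N"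
    if N: "openin ?T N" "0 \<in> N" for N
  proof -
    obtain P where P: "open P" "N = {u. ?ev u \<in> P}" using N(1) opT by blast
    then have "0 \<in> P" using N(2) zero by simp
    then obtain e where e: "e > 0" "ball 0 e \<subseteq> P" using P(1) open_contains_ball by blast
    have "convex {u. ?ev u \<in> ball 0 e}"
      using convex_ball[of "0::real" e] by (auto simp: convex_def add scale)
    moreover have "openin ?T {u. ?ev u \<in> ball 0 e}" using opT open_ball by blast
    ultimately show ?thesis
      using e P zero by (intro exI[of _ "{u. ?ev u \<in> ball 0 e}"]) auto
  qed
  moreover have "continuous_map (F_topology U) ?T (\<lambda>x. x)" if U: "open U" "range of_real \<subseteq> U" for U
    unfolding continuous_map_def
  proof (intro conjI allI impI)
    show "(\<lambda>x. x) \<in> topspace (F_topology U) \<rightarrow> topspace ?T" by (simp add: top)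
    fix V assume "openin ?T V"
    then obtain P where P: "open P" "V = {u. ?ev u \<in> P}" using opT by blast
    have ext: "hol_ext U u (of_real t) = of_real (?ev u)" if "u \<in> F_space U" for u
      using that someI_ex[of "extends_hol U u"]
      by (simp add: F_space_def hol_ext_def extends_hol_def)
    have "connected (range (of_real :: real \<Rightarrow> complex))"
      by (intro connected_continuous_image continuous_intros connected_UNIV)
    then have "range of_real \<subseteq> connected_component_set U 0"
      using U by (intro connected_component_maximal) (auto intro: range_eqI[of _ _ 0])
    then have t: "of_real t \<in> connected_component_set U 0" by blast
    have top_F: "topspace (F_topology U) = F_space U"
      unfolding F_topology_def
    proof (rule topspace_uniform_conv_topology)
      let ?K = "{K. compact K \<and> K \<subseteq> connected_component_set U 0}"
      show "?K \<noteq> {}"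
        using compact_empty by blast
      show "\<forall>K\<in>?K. \<forall>L\<in>?K. \<exists>M\<in>?K. K \<union> L \<subseteq> M"
      proof (intro ballI)
        fix K L assume "K \<in> ?K" "L \<in> ?K"
        then show "\<exists>M\<in>?K. K \<union> L \<subseteq> M" by (intro bexI[of _ "K \<union> L"]) auto
      qed
    qed
    show "openin (F_topology U) {x \<in> topspace (F_topology U). x \<in> V}"
      unfolding openin_F_topology top_F
    proof (intro conjI ballI)
      fix x assume x: "x \<in> {x \<in> F_space U. x \<in> V}"
      then obtain e where e: "e > 0" "\<forall>r. dist r (?ev x) < e \<longrightarrow> r \<in> P"
        using P by (auto simp: open_dist)
      have "y \<in> V" if "y \<in> F_space U" "dist (hol_ext U x (of_real t)) (hol_ext U y (of_real t)) < e" for y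
        using that x e(2) P(2) by (simp add: ext dist_commute)
      then show "\<exists>K. compact K \<and> K \<subseteq> connected_component_set U 0 \<and>
        (\<exists>\<epsilon>>0. \<forall>y\<in>F_space U. (\<forall>z\<in>K. dist (hol_ext U x z) (hol_ext U y z) < \<epsilon>) \<longrightarrow>
          y \<in> {x \<in> F_space U. x \<in> V})"
        using e(1) t by (intro exI[of _ "{of_real t}"]) auto
    qed auto
  qed
  ultimately show "compatible_topology ?T"
    by (auto simp: compatible_topology_def locally_convex_topology_def top)
qed

lemma Hausdorff_ana_topology: "Hausdorff_space ana_topology"
  unfolding Hausdorff_space_def
proof (intro allI impI, elim conjE)
  fix x y :: ana_fun assume "x \<noteq> y"
  then obtain t where t: "ana_apply x t \<noteq> ana_apply y t"
    by (metis ana_apply_inject ext)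
  obtain P Q' where "open P" "open Q'" "ana_apply x t \<in> P" "ana_apply y t \<in> Q'" "P \<inter> Q' = {}"
    using hausdorff[OF t] by blast
  then show "\<exists>V W. openin ana_topology V \<and> openin ana_topology W \<and> x \<in> V \<and> y \<in> W \<and> disjnt V W"
    by (intro exI[of _ "{u. ana_apply u t \<in> P}"] exI[of _ "{u. ana_apply u t \<in> Q'}"])
      (auto simp: openin_ana_topology_eval disjnt_def)
qed


section \<open>Shyness\<close>

definition borel_in :: "'a topology \<Rightarrow> 'a set \<Rightarrow> bool" where
  "borel_in T B \<longleftrightarrow> B \<in> sigma_sets (topspace T) {U. openin T U}"

text \<open>\<open>null_in_translate M x S\<close>: the set \<open>S \<inter> (x + M)\<close> has Lebesgue measure zero in \<open>x + M\<close>.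
  A finite basis \<open>b\<close> of \<open>M\<close> supplies the isomorphism of \<open>\<real>\<^sup>b\<close> with \<open>M\<close>; the choice of \<open>b\<close> does
  not affect null sets. The completed product of copies of \<^const>\<open>lborel\<close> is Lebesgue
  measure on \<open>\<real>\<^sup>b\<close> (the unit mass at a point if \<open>M = {0}\<close>).\<close>

definition null_in_translate :: "'a::real_vector set \<Rightarrow> 'a \<Rightarrow> 'a set \<Rightarrow> bool" where
  "null_in_translate M x S \<longleftrightarrow>
     (\<exists>b. finite b \<and> independent b \<and> span b = M \<and>
        {c \<in> b \<rightarrow>\<^sub>E UNIV. x + (\<Sum>v\<in>b. c v *\<^sub>R v) \<in> S}
          \<in> null_sets (completion (\<Pi>\<^sub>M v\<in>b. (lborel :: real measure))))"

definition shy_in :: "'a::real_vector topology \<Rightarrow> 'a set \<Rightarrow> bool" where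
  "shy_in T S \<longleftrightarrow> (\<exists>\<B>. countable \<B> \<and> S \<subseteq> \<Union>\<B> \<and>
     (\<forall>B\<in>\<B>. borel_in T B \<and>
        (\<exists>M. subspace M \<and> (\<exists>b. finite b \<and> span b = M) \<and>
           (\<forall>x\<in>B. null_in_translate M x (B \<inter> {x + v | v. v \<in> M})))))"


section \<open>Holomorphic maps\<close>

text \<open>There is no type class of complex vector spaces, so the complex scalar multiplications
  \<open>sG\<close> and \<open>sH\<close> are passed explicitly.\<close>

definition has_dir_deriv ::
  "(complex \<Rightarrow> 'g::ab_group_add \<Rightarrow> 'g) \<Rightarrow> (complex \<Rightarrow> 'h::ab_group_add \<Rightarrow> 'h) \<Rightarrow> 'h topology \<Rightarrow>
     ('g \<Rightarrow> 'h) \<Rightarrow> 'g \<Rightarrow> 'g \<Rightarrow> 'h \<Rightarrow> bool" where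
  "has_dir_deriv sG sH TH g x y l \<longleftrightarrow>
     limitin TH (\<lambda>t. sH (inverse t) (g (x + sG t y) - g x)) l (at 0)"

text \<open>\<open>iter_dir_deriv sG sH TH g k x ys\<close> is \<open>d\<^sup>kg(x; y\<^sub>1, \<dots>, y\<^sub>k)\<close> with \<open>y\<^sub>i = ys (i - 1)\<close>.\<close>

primrec iter_dir_deriv ::
  "(complex \<Rightarrow> 'g::ab_group_add \<Rightarrow> 'g) \<Rightarrow> (complex \<Rightarrow> 'h::ab_group_add \<Rightarrow> 'h) \<Rightarrow> 'h topology \<Rightarrow>
     ('g \<Rightarrow> 'h) \<Rightarrow> nat \<Rightarrow> 'g \<Rightarrow> (nat \<Rightarrow> 'g) \<Rightarrow> 'h" where
  "iter_dir_deriv sG sH TH g 0 x ys = g x"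
| "iter_dir_deriv sG sH TH g (Suc k) x ys =
     (THE l. has_dir_deriv sG sH TH (\<lambda>u. iter_dir_deriv sG sH TH g k u ys) x (ys k) l)"

definition holomorphic_map ::
  "(complex \<Rightarrow> 'g::ab_group_add \<Rightarrow> 'g) \<Rightarrow> 'g topology \<Rightarrow>
     (complex \<Rightarrow> 'h::ab_group_add \<Rightarrow> 'h) \<Rightarrow> 'h topology \<Rightarrow> 'g set \<Rightarrow> ('g \<Rightarrow> 'h) \<Rightarrow> bool" where
  "holomorphic_map sG TG sH TH W g \<longleftrightarrow>
     openin TG W \<and>
     continuous_map (subtopology TG W) TH g \<and>
     (\<forall>k. \<forall>x\<in>W. \<forall>ys.
        \<exists>l. has_dir_deriv sG sH TH (\<lambda>u. iter_dir_deriv sG sH TH g k u ys) x (ys k) l) \<and>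
     (\<forall>k\<ge>1. continuous_map
        (prod_topology (subtopology TG W) (product_topology (\<lambda>_. TG) {..<k})) TH
        (\<lambda>(x, ys). iter_dir_deriv sG sH TH g k x ys))"


section \<open>Real analytic maps\<close>

text \<open>Complexification of a real vector space: \<open>(x, y)\<close> stands for \<open>x + \<i>y\<close>.\<close>

definition cx_scale :: "complex \<Rightarrow> 'a::real_vector \<times> 'a \<Rightarrow> 'a \<times> 'a" where
  "cx_scale c = (\<lambda>(x, y). (Re c *\<^sub>R x - Im c *\<^sub>R y, Re c *\<^sub>R y + Im c *\<^sub>R x))"

definition real_analytic_map ::
  "'e::real_vector topology \<Rightarrow> 'f::real_vector topology \<Rightarrow> 'e set \<Rightarrow> ('e \<Rightarrow> 'f) \<Rightarrow> bool" where
  "real_analytic_map TE TF U f \<longleftrightarrow>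
     openin TE U \<and>
     (\<forall>x0\<in>U. \<exists>W g. openin (prod_topology TE TE) W \<and> (x0, 0) \<in> W \<and>
        holomorphic_map cx_scale (prod_topology TE TE) cx_scale (prod_topology TF TF) W g \<and>
        (\<forall>x. (x, 0) \<in> W \<longrightarrow> x \<in> U \<and> g (x, 0) = (f x, 0)))"

lift_definition comp_map :: "ana_fun \<Rightarrow> cont_fun \<Rightarrow> cont_fun" is "\<lambda>\<phi> x t. \<phi> (x t)"
  by (rule continuous_on_compose2[OF real_analytic_fun_imp_continuous]) auto

end

theory Submission
  imports Defs
begin

text \<open>
  The reason for the theorem is the weakness of the topology of \<open>C(\<real>)\<close>: a neighbourhood of \<open>0\<close>
  restricts functions only on a bounded interval, so it contains the whole line spanned by a
  function \<open>r\<close> that vanishes on that interval. If \<open>f\<^sub>\<phi>\<close> has a holomorphic extension \<open>g\<close> near \<open>0\<close>,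
  then \<open>g\<close> is defined at \<open>z r\<close> for every complex \<open>z\<close>. Taking \<open>r\<close> with \<open>r(\<tau>) = 1\<close> and evaluating
  at \<open>\<tau>\<close>, the map \<open>z \<mapsto> g(z r)(\<tau>)\<close> is an entire function whose value at a real number \<open>s\<close> is
  \<open>\<phi>(s)\<close>. Hence real analyticity of \<open>f\<^sub>\<phi>\<close> forces \<open>\<phi>\<close> to be the restriction of an entire function
  (\<open>real_analytic_comp_map_imp_entire\<close>).

  Restrictions of entire functions are rare. Their Taylor series at \<open>0\<close> converges at \<open>1\<close>, so their
  Taylor coefficients tend to zero (\<open>F_space_UNIV_subset\<close>). The functions with this last property
  form a linear subspace of \<open>A(\<real>)\<close> that omits \<open>1 / (1 + t\<^sup>2)\<close>, the coefficients of which are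
  \<open>1, 0, -1, 0, 1, \<dots>\<close>. A line in the direction of a vector outside a linear subspace meets
  the subspace in at most one point, and a point has Lebesgue measure zero
  (\<open>shy_in_vanishing_taylor_coeffs\<close>). What remains is that the subspace is Borel: point evaluations
  are continuous on \<open>A(\<real>)\<close>, and derivatives are limits of difference quotients along a sequence, so
  Taylor coefficients are Borel functions of \<open>\<phi>\<close> (\<open>borel_measurable_taylor_coeff\<close>).
\<close>

section \<open>Taylor coefficients of real analytic functions\<close>

lemma higher_deriv_has_fps_expansion:
  fixes f :: "real \<Rightarrow> real"
  assumes "f has_fps_expansion F"
  shows "(deriv ^^ n) f 0 = fact n * fps_nth F n"
  using assms
proof (induction n arbitrary: f F)
  case 0
  then show ?case
    using eventually_nhds_x_imp_x by (fastforce simp: has_fps_expansion_def eval_fps_at_0)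
next
  case (Suc n)
  have "(deriv ^^ Suc n) f 0 = (deriv ^^ n) (deriv f) 0"
    by (simp add: funpow_Suc_right del: funpow.simps)
  also have "\<dots> = fact n * fps_nth (fps_deriv F) n"
    by (intro Suc.IH has_fps_expansion_deriv Suc.prems)
  finally show ?case by (simp add: algebra_simps)
qed

lemma real_analytic_fun_differentiable:
  assumes "real_analytic_fun f"
  shows "f field_differentiable at t"
proof -
  obtain F where F: "(\<lambda>h. f (t + h)) has_fps_expansion F"
    using assms by (auto simp: real_analytic_fun_def)
  then have "ereal (norm (0::real)) < fps_conv_radius F"
    by (simp add: has_fps_expansion_def zero_ereal_def)
  then have "eval_fps F field_differentiable at 0"
    unfolding field_differentiable_def by (blast intro: has_field_derivative_eval_fps)
  moreover have "eventually (\<lambda>h. eval_fps F h = f (t + h)) (nhds 0)"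
    using F by (simp add: has_fps_expansion_def)
  ultimately have "(\<lambda>h. f (t + h)) field_differentiable at 0"
    by (simp add: field_differentiable_def DERIV_cong_ev[OF refl _ refl])
  then show ?thesis
    unfolding field_differentiable_def using DERIV_shift[of f _ 0 t] by (simp add: add.commute)
qed

lemma real_analytic_fun_deriv:
  assumes "real_analytic_fun f"
  shows "real_analytic_fun (deriv f)"
  unfolding real_analytic_fun_def
proof
  fix t
  obtain F where "(\<lambda>h. f (t + h)) has_fps_expansion F"
    using assms by (auto simp: real_analytic_fun_def)
  then have "deriv (\<lambda>h. f (t + h)) has_fps_expansion fps_deriv F"
    by (rule has_fps_expansion_deriv)
  also have "deriv (\<lambda>h. f (t + h)) = (\<lambda>h. deriv f (t + h))"
    using DERIV_shift[of f _ _ t] by (simp add: deriv_def fun_eq_iff add.commute)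
  finally show "\<exists>F. (\<lambda>h. deriv f (t + h)) has_fps_expansion F" ..
qed

lemma real_analytic_fun_higher_deriv:
  "real_analytic_fun f \<Longrightarrow> real_analytic_fun ((deriv ^^ n) f)"
  by (induction n) (auto intro: real_analytic_fun_deriv)

definition taylor_coeff :: "ana_fun \<Rightarrow> nat \<Rightarrow> real" where
  "taylor_coeff \<phi> n = (deriv ^^ n) (ana_apply \<phi>) 0 / fact n"

lemma taylor_coeff_eq:
  "ana_apply \<phi> has_fps_expansion F \<Longrightarrow> taylor_coeff \<phi> n = fps_nth F n"
  by (simp add: taylor_coeff_def higher_deriv_has_fps_expansion)

lemma taylor_coeff_add_scaleR:
  "taylor_coeff (\<phi> + c *\<^sub>R \<psi>) n = taylor_coeff \<phi> n + c * taylor_coeff \<psi> n"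
proof -
  have "\<exists>F. ana_apply \<omega> has_fps_expansion F" for \<omega>
  proof -
    obtain F where "(\<lambda>h. ana_apply \<omega> (0 + h)) has_fps_expansion F"
      using ana_apply[of \<omega>] unfolding real_analytic_fun_def by blast
    then show ?thesis by (auto simp only: add_0)
  qed
  then obtain F G where F: "ana_apply \<phi> has_fps_expansion F" and G: "ana_apply \<psi> has_fps_expansion G"
    by blast
  have "ana_apply (\<phi> + c *\<^sub>R \<psi>) = (\<lambda>t. ana_apply \<phi> t + c * ana_apply \<psi> t)"
    by transfer simp
  then have "ana_apply (\<phi> + c *\<^sub>R \<psi>) has_fps_expansion F + fps_const c * G"
    using F G by (simp add: has_fps_expansion_add has_fps_expansion_cmult_left)
  then show ?thesis
    by (simp add: taylor_coeff_eq[OF F] taylor_coeff_eq[OF G] taylor_coeff_eq)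
qed

section \<open>Measurability of Taylor coefficients\<close>

lemma topspace_ana_topology: "topspace ana_topology = UNIV"
  using compatible_ana_topology by (simp add: compatible_topology_def locally_convex_topology_def)

abbreviation ana_borel :: "ana_fun measure" where
  "ana_borel \<equiv> sigma UNIV {U. openin ana_topology U}"

lemma borel_in_ana_topology: "borel_in ana_topology B \<longleftrightarrow> B \<in> sets ana_borel"
  by (simp add: borel_in_def topspace_ana_topology sets_measure_of_conv)

lemma borel_measurable_eval: "(\<lambda>\<phi>. ana_apply \<phi> t) \<in> borel_measurable ana_borel"
proof (rule borel_measurableI)
  fix P :: "real set" assume "open P"
  then show "(\<lambda>\<phi>. ana_apply \<phi> t) -` P \<inter> space ana_borel \<in> sets ana_borel"
    using openin_ana_topology_eval[of P t]
    by (auto simp: vimage_def space_measure_of_conv sets_measure_of_conv intro: sigma_sets.Basic)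
qed

text \<open>
  Difference quotients with increments \<open>1 / (m + 1)\<close> exhibit each derivative as a pointwise limit of a
  sequence of functions that are already known to be Borel.
  The induction starts from the continuity of point evaluations.
\<close>

lemma borel_measurable_higher_deriv:
  "(\<lambda>\<phi>. (deriv ^^ n) (ana_apply \<phi>) t) \<in> borel_measurable ana_borel"
proof (induction n arbitrary: t)
  case 0
  then show ?case by (simp add: borel_measurable_eval)
next
  case (Suc n)
  let ?D = "\<lambda>\<phi>. (deriv ^^ n) (ana_apply \<phi>)"
  let ?h = "\<lambda>m::nat. inverse (real (Suc m))"
  show ?case
  proof (rule borel_measurable_LIMSEQ_real)
    show "(\<lambda>\<phi>. (?D \<phi> (t + ?h m) - ?D \<phi> t) / ?h m) \<in> borel_measurable ana_borel" for m
      using Suc.IH by measurable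
    fix \<phi> :: ana_fun
    have "real_analytic_fun (?D \<phi>)"
      using ana_apply[of \<phi>] by (auto intro: real_analytic_fun_higher_deriv)
    then have "(?D \<phi> has_field_derivative deriv (?D \<phi>) t) (at t)"
      by (simp add: DERIV_deriv_iff_field_differentiable real_analytic_fun_differentiable)
    then have "((\<lambda>h. (?D \<phi> (t + h) - ?D \<phi> t) / h) \<longlongrightarrow> deriv (?D \<phi>) t) (at 0)"
      by (simp add: DERIV_def)
    moreover have "filterlim ?h (at 0) sequentially"
      using LIMSEQ_inverse_real_of_nat by (auto simp: filterlim_at simp del: of_nat_Suc)
    ultimately show "(\<lambda>m. (?D \<phi> (t + ?h m) - ?D \<phi> t) / ?h m) \<longlonglongrightarrow> (deriv ^^ Suc n) (ana_apply \<phi>) t"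
      by (auto intro: filterlim_compose)
  qed
qed

lemma borel_measurable_taylor_coeff: "(\<lambda>\<phi>. taylor_coeff \<phi> n) \<in> borel_measurable ana_borel"
  unfolding taylor_coeff_def by (intro borel_measurable_divide borel_measurable_higher_deriv) simp

text \<open>
  A Borel linear subspace lying between the restrictions of entire functions and \<open>A(\<real>)\<close>. It replaces
  the former in the proof of shyness because its definition by countably many Borel conditions
  makes it visibly Borel.
\<close>

definition vanishing_taylor_coeffs :: "ana_fun set" where
  "vanishing_taylor_coeffs = {\<phi>. taylor_coeff \<phi> \<longlonglongrightarrow> 0}"

lemma borel_in_vanishing_taylor_coeffs: "borel_in ana_topology vanishing_taylor_coeffs"
proof -
  note [measurable] = borel_measurable_taylor_coeff
  have "{\<phi> \<in> space ana_borel. \<forall>k. \<exists>N. \<forall>n. N \<le> n \<longrightarrow> \<bar>taylor_coeff \<phi> n\<bar> < inverse (real (Suc k))}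
      \<in> sets ana_borel"
    by measurable
  also have "{\<phi> \<in> space ana_borel. \<forall>k. \<exists>N. \<forall>n. N \<le> n \<longrightarrow> \<bar>taylor_coeff \<phi> n\<bar> < inverse (real (Suc k))}
      = vanishing_taylor_coeffs"
  proof -
    have "(\<forall>k. \<exists>N. \<forall>n. N \<le> n \<longrightarrow> \<bar>a n\<bar> < inverse (real (Suc k))) \<longleftrightarrow> a \<longlonglongrightarrow> 0" for a :: "nat \<Rightarrow> real"
    proof
      assume L: "\<forall>k. \<exists>N. \<forall>n. N \<le> n \<longrightarrow> \<bar>a n\<bar> < inverse (real (Suc k))"
      show "a \<longlonglongrightarrow> 0"
      proof (rule LIMSEQ_I)
        fix r :: real assume "0 < r"
        then obtain k where "inverse (real (Suc k)) < r"
          using reals_Archimedean by blast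
        then show "\<exists>N. \<forall>n\<ge>N. norm (a n - 0) < r"
          using L by (metis diff_zero order_less_trans real_norm_def)
      qed
    next
      assume "a \<longlonglongrightarrow> 0"
      then show "\<forall>k. \<exists>N. \<forall>n. N \<le> n \<longrightarrow> \<bar>a n\<bar> < inverse (real (Suc k))"
        using LIMSEQ_D[of a 0] by fastforce
    qed
    then show ?thesis
      by (simp add: vanishing_taylor_coeffs_def space_measure_of_conv)
  qed
  finally show ?thesis
    by (simp only: borel_in_ana_topology)
qed

section \<open>The transversal direction\<close>

lift_definition agnesi :: ana_fun is "\<lambda>t. inverse (1 + t\<^sup>2)"
  unfolding real_analytic_fun_def
proof
  fix t :: real
  have "(\<lambda>h. inverse (1 + (t + h)\<^sup>2)) has_fps_expansion inverse (1 + (fps_const t + fps_X)\<^sup>2)"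
    by (intro fps_expansion_intros)
       (use sum_power2_ge_zero[of 1 t] in \<open>auto simp: power2_eq_square add_nonneg_eq_0_iff\<close>)
  then show "\<exists>F. (\<lambda>h. inverse (1 + (t + h)\<^sup>2)) has_fps_expansion F" ..
qed

text \<open>
  The power series of \<open>1 / (1 + t\<^sup>2)\<close> multiplied by \<open>1 + t\<^sup>2\<close> is \<open>1\<close>, so consecutive even
  coefficients differ by a sign. They stay away from zero because of the poles at \<open>\<plusminus>\<i>\<close>, which lie on
  the unit circle.
\<close>

lemma taylor_coeff_agnesi: "\<bar>taylor_coeff agnesi (2 * k)\<bar> = 1"
proof -
  let ?G = "1 + fps_X\<^sup>2 :: real fps"
  have "(\<lambda>t::real. inverse (1 + t\<^sup>2)) has_fps_expansion inverse ?G"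
    by (intro fps_expansion_intros) auto
  then have coeff: "taylor_coeff agnesi n = fps_nth (inverse ?G) n" for n
    by (intro taylor_coeff_eq) (simp add: agnesi.rep_eq)
  have "inverse ?G * ?G = 1"
    by (rule inverse_mult_eq_1) simp
  then have eq: "inverse ?G + fps_X\<^sup>2 * inverse ?G = 1"
    by (simp add: algebra_simps)
  show ?thesis
  proof (induction k)
    case 0
    then show ?case by (simp add: coeff)
  next
    case (Suc k)
    have "fps_nth (inverse ?G + fps_X\<^sup>2 * inverse ?G) (2 * Suc k) = 0"
      by (simp add: eq)
    then have "fps_nth (inverse ?G) (2 * Suc k) = - fps_nth (inverse ?G) (2 * k)"
      by (simp add: fps_X_power_mult_nth)
    with Suc.IH show ?case by (simp add: coeff)
  qed
qed

text \<open>
  The difference of two points of the subspace on one line is a multiple of \<^const>\<open>agnesi\<close>, which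
  does not belong to the subspace.
\<close>

lemma agnesi_line_meets_once:
  assumes "\<phi> + c *\<^sub>R agnesi \<in> vanishing_taylor_coeffs" "\<phi> + d *\<^sub>R agnesi \<in> vanishing_taylor_coeffs"
  shows "c = d"
proof (rule ccontr)
  assume "c \<noteq> d"
  have "(\<lambda>n. (taylor_coeff (\<phi> + c *\<^sub>R agnesi) n - taylor_coeff (\<phi> + d *\<^sub>R agnesi) n) / (c - d)) \<longlonglongrightarrow> (0 - 0) / (c - d)"
    using assms \<open>c \<noteq> d\<close> by (intro tendsto_intros) (auto simp: vanishing_taylor_coeffs_def)
  also have "(\<lambda>n. (taylor_coeff (\<phi> + c *\<^sub>R agnesi) n - taylor_coeff (\<phi> + d *\<^sub>R agnesi) n) / (c - d)) = taylor_coeff agnesi"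
    using \<open>c \<noteq> d\<close> by (auto simp: taylor_coeff_add_scaleR fun_eq_iff field_simps)
  finally have "(\<lambda>k. \<bar>taylor_coeff agnesi (2 * k)\<bar>) \<longlonglongrightarrow> 0"
    by (intro tendsto_rabs_zero LIMSEQ_subseq_LIMSEQ[of "taylor_coeff agnesi" 0 "\<lambda>k. 2 * k", unfolded o_def])
      (auto simp: strict_mono_def)
  then show False by (simp add: taylor_coeff_agnesi LIMSEQ_const_iff)
qed

lemma null_in_translate_line:
  fixes v :: "'a::real_vector"
  assumes "v \<noteq> 0" and once: "\<And>c d. x + c *\<^sub>R v \<in> S \<Longrightarrow> x + d *\<^sub>R v \<in> S \<Longrightarrow> c = d"
  shows "null_in_translate (span {v}) x S"
  unfolding null_in_translate_def
proof (intro exI[of _ "{v}"] conjI)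
  show "independent {v}" using \<open>v \<noteq> 0\<close> by simp
  obtain c0 where c0: "\<And>c. x + c *\<^sub>R v \<in> S \<Longrightarrow> c = c0"
    using once by metis
  interpret product_sigma_finite "\<lambda>_::'a. lborel :: real measure" ..
  have "Pi\<^sub>E {v} (\<lambda>_. {c0}) \<in> null_sets (\<Pi>\<^sub>M v\<in>{v}. (lborel :: real measure))"
  proof (rule null_setsI)
    have "emeasure (\<Pi>\<^sub>M v\<in>{v}. (lborel :: real measure)) (Pi\<^sub>E {v} (\<lambda>_. {c0}))
        = (\<Prod>v\<in>{v}. emeasure lborel {c0})"
      by (rule emeasure_PiM) auto
    then show "emeasure (\<Pi>\<^sub>M v\<in>{v}. (lborel :: real measure)) (Pi\<^sub>E {v} (\<lambda>_. {c0})) = 0"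
      by (simp only: emeasure_lborel_singleton prod.insert finite.emptyI empty_iff not_False_eq_True mult_zero_left)
  qed (rule sets_PiM_I_finite; simp)
  moreover have "{c \<in> {v} \<rightarrow>\<^sub>E UNIV. x + (\<Sum>v\<in>{v}. c v *\<^sub>R v) \<in> S} \<subseteq> Pi\<^sub>E {v} (\<lambda>_. {c0})"
    by (auto simp: PiE_iff extensional_def fun_eq_iff dest: c0)
  ultimately show "{c \<in> {v} \<rightarrow>\<^sub>E UNIV. x + (\<Sum>v\<in>{v}. c v *\<^sub>R v) \<in> S}
      \<in> null_sets (completion (\<Pi>\<^sub>M v\<in>{v}. (lborel :: real measure)))"
    by (rule null_sets_completion_subset[rotated, OF null_sets_completionI])
qed auto

lemma shy_in_vanishing_taylor_coeffs:
  assumes "S \<subseteq> vanishing_taylor_coeffs"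
  shows "shy_in ana_topology S"
  unfolding shy_in_def
proof (intro exI[of _ "{vanishing_taylor_coeffs}"] conjI ballI)
  fix B assume B: "B \<in> {vanishing_taylor_coeffs}"
  then show "borel_in ana_topology B"
    by (simp add: borel_in_vanishing_taylor_coeffs)
  have "agnesi \<noteq> 0"
    by transfer (auto simp: fun_eq_iff intro!: exI[of _ 0])
  then show "\<exists>M. subspace M \<and> (\<exists>b. finite b \<and> span b = M) \<and>
      (\<forall>x\<in>B. null_in_translate M x (B \<inter> {x + v |v. v \<in> M}))"
    using B
    by (intro exI[of _ "span {agnesi}"] conjI exI[of _ "{agnesi}"] ballI null_in_translate_line)
      (auto dest: agnesi_line_meets_once)
qed (use assms in auto)

section \<open>Restrictions of entire functions\<close>

text \<open>
  The real parts of the complex Taylor coefficients give a power series that represents the real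
  function everywhere; convergence at \<open>t = 1\<close> forces the coefficients to tend to zero.
\<close>

lemma F_space_UNIV_subset: "F_space UNIV \<subseteq> vanishing_taylor_coeffs"
proof
  fix \<phi> assume "\<phi> \<in> F_space UNIV"
  then obtain h where hol: "h holomorphic_on UNIV" and h: "\<And>t. h (of_real t) = of_real (ana_apply \<phi> t)"
    by (auto simp: F_space_def extends_hol_def)
  define c where "c n = (deriv ^^ n) h 0 / fact n" for n
  have sums: "(\<lambda>n. c n * z ^ n) sums h z" for z
    using holomorphic_power_series[of h 0 "norm z + 1" z] hol
    by (auto simp: c_def dist_norm intro: holomorphic_on_subset)
  have re: "(\<lambda>n. Re (c n) * t ^ n) sums ana_apply \<phi> t" for t
    using sums_Re[OF sums[of "of_real t"]] by (simp add: h flip: of_real_power)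
  have "fps_conv_radius (Abs_fps (\<lambda>n. Re (c n))) = \<infinity>"
    unfolding fps_conv_radius_def fps_nth_Abs_fps
    by (rule conv_radius_inftyI'') (rule sums_summable[OF re])
  then have "ana_apply \<phi> has_fps_expansion Abs_fps (\<lambda>n. Re (c n))"
    using re by (auto simp: has_fps_expansion_def eval_fps_def sums_iff)
  then have "taylor_coeff \<phi> = (\<lambda>n. Re (c n) * 1 ^ n)"
    by (auto simp: taylor_coeff_eq)
  then show "\<phi> \<in> vanishing_taylor_coeffs"
    using summable_LIMSEQ_zero[OF sums_summable[OF re[of 1]]] by (simp add: vanishing_taylor_coeffs_def)
qed

section \<open>Real analytic composition maps come from entire functions\<close>

lemma continuous_map_cont_eval: "continuous_map cont_topology euclideanreal (\<lambda>u. cont_apply u t)"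
proof -
  have op: "openin cont_topology {u. cont_apply u t \<in> P}" if P: "open P" for P
    unfolding openin_cont_topology
  proof
    fix u assume "u \<in> {u. cont_apply u t \<in> P}"
    then obtain e where "e > 0" "\<forall>r. dist r (cont_apply u t) < e \<longrightarrow> r \<in> P"
      using P by (auto simp: open_dist)
    then show "\<exists>a b. \<exists>\<epsilon>>0. \<forall>v. (\<forall>s\<in>{a..b}. dist (cont_apply u s) (cont_apply v s) < \<epsilon>) \<longrightarrow>
        v \<in> {u. cont_apply u t \<in> P}"
      by (intro exI[of _ t] exI[of _ e]) (auto simp: dist_commute)
  qed
  have "topspace cont_topology = UNIV"
    using op[of UNIV] openin_subset by fastforce
  with op show ?thesis
    by (simp add: continuous_map_def)
qed

text \<open>
  Point evaluation on the complexification of \<open>C(\<real>)\<close>, seen as the space of complex-valued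
  functions; it is continuous and complex linear, so it turns directional derivatives into complex
  derivatives.
\<close>

definition cx_eval :: "real \<Rightarrow> cont_fun \<times> cont_fun \<Rightarrow> complex" where
  "cx_eval t u = Complex (cont_apply (fst u) t) (cont_apply (snd u) t)"

lemma continuous_map_cx_eval:
  "continuous_map (prod_topology cont_topology cont_topology) euclidean (cx_eval t)"
proof -
  have "continuous_map (prod_topology cont_topology cont_topology) (prod_topology euclideanreal euclideanreal)
      (\<lambda>u. (cont_apply (fst u) t, cont_apply (snd u) t))"
    unfolding continuous_map_pairwise
    using continuous_map_compose[OF continuous_map_fst continuous_map_cont_eval[of t], of cont_topology]
      continuous_map_compose[OF continuous_map_snd continuous_map_cont_eval[of t], of cont_topology]
    by (auto simp: o_def)
  moreover have "continuous_map (prod_topology euclideanreal euclideanreal) euclidean (\<lambda>(r, s). Complex r s)"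
    by (simp add: case_prod_unfold Complex_eq) (intro continuous_intros)
  ultimately have "continuous_map (prod_topology cont_topology cont_topology) euclidean
      ((\<lambda>(r, s). Complex r s) \<circ> (\<lambda>u. (cont_apply (fst u) t, cont_apply (snd u) t)))"
    by (rule continuous_map_compose)
  then show ?thesis
    by (simp add: cx_eval_def[abs_def] o_def)
qed

lemma cx_eval_diff: "cx_eval t (u - w) = cx_eval t u - cx_eval t w"
  by (simp add: cx_eval_def complex_eq_iff minus_cont_fun.rep_eq)

lemma cx_eval_cx_scale: "cx_eval t (cx_scale c u) = c * cx_eval t u"
  by (auto simp: cx_eval_def cx_scale_def complex_eq_iff minus_cont_fun.rep_eq plus_cont_fun.rep_eq
      scaleR_cont_fun.rep_eq split: prod.splits)

text \<open>
  Uniform closeness on \<open>[a, b]\<close> says nothing about the values to the right of \<open>b\<close>, so every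
  neighbourhood of zero contains a large linear subspace. The argument breaks down for
  normed spaces of functions, where composition with a non-entire \<open>\<phi>\<close> may well be real analytic.
\<close>

lemma zero_nhd_contains_tail:
  assumes "openin cont_topology V" "0 \<in> V"
  obtains b where "\<And>u. (\<And>t. t \<le> b \<Longrightarrow> cont_apply u t = 0) \<Longrightarrow> u \<in> V"
proof -
  obtain a b e where "e > 0" and V: "\<And>y. \<forall>t\<in>{a..b}. dist (cont_apply 0 t) (cont_apply y t) < e \<Longrightarrow> y \<in> V"
    using assms unfolding openin_cont_topology by blast
  then show ?thesis
    by (intro that[of b] V) (simp add: zero_cont_fun.rep_eq)
qed

lift_definition ramp :: "real \<Rightarrow> cont_fun" is "\<lambda>b t. max 0 (t - b)"
  by (intro continuous_intros)

text \<open>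
  Along the complex line through the origin spanned by a ramp starting at \<open>b\<close>, the local holomorphic
  extension is defined everywhere. Its value at the point \<open>b + 1\<close>, where the ramp equals one, is the
  entire extension of \<open>\<phi>\<close>.
\<close>

lemma real_analytic_comp_map_imp_entire:
  assumes "real_analytic_map cont_topology cont_topology UNIV (comp_map \<phi>)"
  shows "\<phi> \<in> F_space UNIV"
proof -
  let ?T = "prod_topology cont_topology cont_topology"
  obtain W g where W: "openin ?T W" "(0, 0) \<in> W"
    and hol: "holomorphic_map cx_scale ?T cx_scale ?T W g"
    and g: "\<And>x. (x, 0) \<in> W \<Longrightarrow> g (x, 0) = (comp_map \<phi> x, 0)"
    using assms unfolding real_analytic_map_def by blast
  obtain V1 V2 where V: "openin cont_topology V1" "openin cont_topology V2" "0 \<in> V1" "0 \<in> V2"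
    "V1 \<times> V2 \<subseteq> W"
    using W(1)[unfolded openin_prod_topology_alt, rule_format, OF W(2)] by (elim exE conjE) (rule that)
  obtain b1 where b1: "\<And>u. (\<And>t. t \<le> b1 \<Longrightarrow> cont_apply u t = 0) \<Longrightarrow> u \<in> V1"
    using zero_nhd_contains_tail[OF V(1) V(3)] by blast
  obtain b2 where b2: "\<And>u. (\<And>t. t \<le> b2 \<Longrightarrow> cont_apply u t = 0) \<Longrightarrow> u \<in> V2"
    using zero_nhd_contains_tail[OF V(2) V(4)] by blast
  define b where "b = max b1 b2"
  define p where "p z = cx_scale z (ramp b, 0)" for z
  have pW: "p z \<in> W" for z
  proof -
    have "Re z *\<^sub>R ramp b \<in> V1" "Im z *\<^sub>R ramp b \<in> V2"
      by (auto intro!: b1 b2 simp: b_def scaleR_cont_fun.rep_eq ramp.rep_eq)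
    then show ?thesis
      using V(5) by (auto simp: p_def cx_scale_def)
  qed
  have p_add: "p (z + w) = p z + cx_scale w (ramp b, 0)" for z w
    by (simp add: p_def cx_scale_def scaleR_add_left)
  have p_real: "p (of_real s) = (s *\<^sub>R ramp b, 0)" for s
    by (simp add: p_def cx_scale_def)
  define h where "h z = cx_eval (b + 1) (g (p z))" for z
  have "extends_hol UNIV \<phi> h"
    unfolding extends_hol_def
  proof (intro conjI allI)
    show "h (of_real s) = of_real (ana_apply \<phi> s)" for s
      using g[of "s *\<^sub>R ramp b"] pW[of "of_real s"]
      by (simp add: h_def p_real cx_eval_def comp_map.rep_eq scaleR_cont_fun.rep_eq ramp.rep_eq
          zero_cont_fun.rep_eq complex_eq_iff)
    have "h field_differentiable at z" for z
    proof -
      \<comment> \<open>Order \<open>0\<close> of the iterated derivative is \<open>g\<close> itself, so this is the first derivative of \<open>g\<close>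
        in the direction of the ramp.\<close>
      have "\<exists>l. has_dir_deriv cx_scale cx_scale ?T
          (\<lambda>u. iter_dir_deriv cx_scale cx_scale ?T g 0 u (\<lambda>_. (ramp b, 0))) (p z) (ramp b, 0) l"
        using hol pW[of z] unfolding holomorphic_map_def by blast
      then obtain l where "limitin ?T
          (\<lambda>w. cx_scale (inverse w) (g (p z + cx_scale w (ramp b, 0)) - g (p z))) l (at 0)"
        by (auto simp: has_dir_deriv_def)
      from continuous_map_limit[OF continuous_map_cx_eval[of "b + 1"] this]
      have "((\<lambda>w. (h (z + w) - h z) / w) \<longlongrightarrow> cx_eval (b + 1) l) (at 0)"
        by (simp add: o_def cx_eval_cx_scale cx_eval_diff h_def p_add divide_inverse mult.commute)
      then show ?thesis
        by (auto simp: field_differentiable_def DERIV_def)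
    qed
    then show "h holomorphic_on UNIV"
      by (simp add: holomorphic_on_def)
  qed
  then show ?thesis
    by (auto simp: F_space_def)
qed

theorem mainTheorem4:
  shows "shy_in ana_topology
           {\<phi> :: ana_fun. real_analytic_map cont_topology cont_topology UNIV (comp_map \<phi>)}"
  using real_analytic_comp_map_imp_entire F_space_UNIV_subset
  by (intro shy_in_vanishing_taylor_coeffs) blast

end
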